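(* For any $n\ge1$, there exists a bi-Lipschitz embedding of the sphere $\mathbb{S}^n$ into the Heisenberg group $\mathbb{H}^n$ equipped with the Carnot-Carathéodory metric $d_{cc}$.
   Context: $\mathbb{S}^n$ is the unit sphere of $\mathbb{R}^{n+1}$ with its standard metric. Heisenberg group: $\mathbb{H}^n=\mathbb{C}^n\times\mathbb{R}=\mathbb{R}^{2n+1}$ with points $(z,t)=(x_1,y_1,\dots,x_n,y_n,t)$ and group law $(z,t)*(z',t')=(z+z',\,t+t'+2\,\mathrm{Im}\sum_{j=1}^n z_j\overline{z_j'})$. The horizontal space at a point is the span of $X_j=\partial_{x_j}+2y_j\partial_t$, $Y_j=\partial_{y_j}-2x_j\partial_t$, $j=1,\dots,n$; these vectors are declared orthonormal. An absolutely continuous curve is horizontal if its derivative is horizontal a.e.; $d_{cc}(p,q)$ is the infimum of the lengths of horizontal curves joining $p$ and $q$. *)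

theory Defs
  imports "HOL-Analysis.Analysis"
begin

section \<open>The Heisenberg group\<close>

text \<open>
  With \<open>n = CARD('n)\<close>, a point is \<open>(z, t)\<close> with \<open>z \<in> \<complex>\<^sup>n\<close>, \<open>t \<in> \<real>\<close>, and \<open>x\<^sub>j = Re (z $ j)\<close>,
  \<open>y\<^sub>j = Im (z $ j)\<close>. The type-class metric on this product type is the Euclidean metric of
  \<open>\<real>\<^bsup>2n+1\<^esup>\<close>; the Carnot-Caratheodory metric is the function \<open>d_cc\<close> below. Tangent vectors at a
  point are elements of the same type, \<open>axis j 1\<close> and \<open>axis j \<i>\<close> in the first component being
  \<open>\<partial>/\<partial>x\<^sub>j\<close> and \<open>\<partial>/\<partial>y\<^sub>j\<close>.
\<close>

type_synonym 'n heis = "(complex ^ 'n) \<times> real"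

definition heis_mult :: "'n::finite heis \<Rightarrow> 'n heis \<Rightarrow> 'n heis" where
  "heis_mult p q =
    (fst p + fst q, snd p + snd q + 2 * Im (\<Sum>j\<in>UNIV. fst p $ j * cnj (fst q $ j)))"

definition heis_X :: "'n::finite \<Rightarrow> 'n heis \<Rightarrow> 'n heis" where
  "heis_X j p = (axis j 1, 2 * Im (fst p $ j))"

definition heis_Y :: "'n::finite \<Rightarrow> 'n heis \<Rightarrow> 'n heis" where
  "heis_Y j p = (axis j \<i>, - 2 * Re (fst p $ j))"

text \<open>The fields are invariant under left translations.\<close>

lemma heis_left_invariant:
  fixes p q :: "'n::finite heis"
  defines "D \<equiv> \<lambda>v::'n heis. (fst v, snd v + 2 * Im (\<Sum>j\<in>UNIV. fst p $ j * cnj (fst v $ j)))"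
  shows "(heis_mult p has_derivative D) (at q)"
    and "D (heis_X j q) = heis_X j (heis_mult p q)"
    and "D (heis_Y j q) = heis_Y j (heis_mult p q)"
proof -
  have bl: "bounded_linear D"
    unfolding D_def
    by (rule linear_conv_bounded_linear[THEN iffD1], rule linearI)
       (auto simp: algebra_simps sum.distrib sum_distrib_left sum_subtractf)
  have eq: "heis_mult p = (\<lambda>v. (fst p, snd p) + D v)"
    by (auto simp: heis_mult_def D_def fun_eq_iff prod_eq_iff)
  show "(heis_mult p has_derivative D) (at q)"
    unfolding eq using bounded_linear_imp_has_derivative[OF bl, of "at q"]
    by (auto intro!: derivative_eq_intros)
  show "D (heis_X j q) = heis_X j (heis_mult p q)"
    by (simp add: D_def heis_X_def heis_mult_def axis_def if_distrib if_distribR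
        sum.delta cong: if_cong)
  show "D (heis_Y j q) = heis_Y j (heis_mult p q)"
    by (simp add: D_def heis_Y_def heis_mult_def axis_def if_distrib if_distribR
        sum.delta cong: if_cong)
qed

section \<open>Horizontal curves and the Carnot-Caratheodory metric\<close>

definition horizontal_space :: "'n::finite heis \<Rightarrow> 'n heis set" where
  "horizontal_space p = span (range (\<lambda>j. heis_X j p) \<union> range (\<lambda>j. heis_Y j p))"

text \<open>
  The norm of the inner product on \<open>horizontal_space p\<close> for which the \<open>X\<^sub>j\<close>, \<open>Y\<^sub>j\<close> are orthonormal;
  unspecified outside the horizontal space.
\<close>

definition horizontal_norm :: "'n::finite heis \<Rightarrow> 'n heis \<Rightarrow> real" where
  "horizontal_norm p v =
    (THE r. \<exists>a b. v = (\<Sum>j\<in>UNIV. a j *\<^sub>R heis_X j p + b j *\<^sub>R heis_Y j p) \<and>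
                  r = sqrt (\<Sum>j\<in>UNIV. (a j)\<^sup>2 + (b j)\<^sup>2))"

lemma horizontal_norm_eq:
  fixes p :: "'n::finite heis"
  shows "horizontal_norm p (\<Sum>j\<in>UNIV. a j *\<^sub>R heis_X j p + b j *\<^sub>R heis_Y j p)
           = sqrt (\<Sum>j\<in>UNIV. (a j)\<^sup>2 + (b j)\<^sup>2)"
proof -
  define V where "V a b = (\<Sum>j\<in>UNIV. a j *\<^sub>R heis_X j p + b j *\<^sub>R heis_Y j p)" for a b
  have comp: "fst (V a b) $ i = Complex (a i) (b i)" for a b i
  proof -
    have "fst (V a b) $ i =
        (\<Sum>j\<in>UNIV. if j = i then Complex (a j) (b j) else 0)"
      unfolding V_def fst_sum sum_component
      by (intro sum.cong refl) (auto simp: heis_X_def heis_Y_def axis_def complex_eq_iff)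
    then show ?thesis by simp
  qed
  have "a' = a \<and> b' = b" if "V a b = V a' b'" for a' b'
    using comp[of a b] comp[of a' b'] that by (auto simp: fun_eq_iff)
  then show ?thesis
    unfolding horizontal_norm_def V_def[symmetric] by (intro the_equality) auto
qed

definition absolutely_continuous_curve ::
    "real \<Rightarrow> real \<Rightarrow> (real \<Rightarrow> 'a::metric_space) \<Rightarrow> bool" where
  "absolutely_continuous_curve a b \<gamma> \<longleftrightarrow>
    (\<forall>\<epsilon>>0. \<exists>\<delta>>0. \<forall>(N::nat) u v.
       (\<forall>i<N. a \<le> u i \<and> u i \<le> v i \<and> v i \<le> b) \<and>
       (\<forall>i<N. \<forall>j<N. i \<noteq> j \<longrightarrow> {u i<..<v i} \<inter> {u j<..<v j} = {}) \<and>
       (\<Sum>i<N. v i - u i) < \<delta>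
       \<longrightarrow> (\<Sum>i<N. dist (\<gamma> (u i)) (\<gamma> (v i))) < \<epsilon>)"

definition horizontal_curve :: "real \<Rightarrow> real \<Rightarrow> (real \<Rightarrow> 'n::finite heis) \<Rightarrow> bool" where
  "horizontal_curve a b \<gamma> \<longleftrightarrow>
    absolutely_continuous_curve a b \<gamma> \<and>
    (AE t in lebesgue. t \<in> {a..b} \<longrightarrow>
       \<gamma> differentiable (at t) \<and> vector_derivative \<gamma> (at t) \<in> horizontal_space (\<gamma> t))"

definition horizontal_length :: "real \<Rightarrow> real \<Rightarrow> (real \<Rightarrow> 'n::finite heis) \<Rightarrow> ennreal" where
  "horizontal_length a b \<gamma> =
    (\<integral>\<^sup>+t\<in>{a..b}. ennreal (horizontal_norm (\<gamma> t) (vector_derivative \<gamma> (at t))) \<partial>lebesgue)"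

text \<open>
  The infimum is taken in \<^typ>\<open>ennreal\<close>, where it is finite because any two points are joined
  by a horizontal curve of finite length.
\<close>

definition d_cc :: "'n::finite heis \<Rightarrow> 'n heis \<Rightarrow> real" where
  "d_cc p q =
    enn2real (Inf {horizontal_length a b \<gamma> | a b \<gamma>.
      a \<le> b \<and> horizontal_curve a b \<gamma> \<and> \<gamma> a = p \<and> \<gamma> b = q})"

section \<open>Spheres and bi-Lipschitz embeddings\<close>

text \<open>
  The round (geodesic) metric on the unit sphere. It satisfies
  \<open>dist x y \<le> sphere_dist x y \<le> pi / 2 * dist x y\<close> for unit vectors, so bi-Lipschitz statements
  do not distinguish it from the chordal metric.
\<close>

definition sphere_dist :: "'a::real_inner \<Rightarrow> 'a \<Rightarrow> real" where
  "sphere_dist x y = arccos (x \<bullet> y)"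

text \<open>The metrics are explicit arguments, since \<open>d_cc\<close> is not the type-class metric.\<close>

definition bilipschitz_embedding ::
    "'a set \<Rightarrow> ('a \<Rightarrow> 'a \<Rightarrow> real) \<Rightarrow> ('b \<Rightarrow> 'b \<Rightarrow> real) \<Rightarrow> ('a \<Rightarrow> 'b) \<Rightarrow> bool" where
  "bilipschitz_embedding S dS dT f \<longleftrightarrow>
    (\<exists>L\<ge>1. \<forall>x\<in>S. \<forall>y\<in>S. dS x y / L \<le> dT (f x) (f y) \<and> dT (f x) (f y) \<le> L * dS x y)"

end

theory Submission
  imports Defs
begin

text \<open>
  The sphere \<open>|x|\<^sup>2 + s\<^sup>2 = 1\<close> in \<open>\<real>\<^sup>n \<times> \<real>\<close> is embedded by the Legendrian lift
  \<open>(x, s) \<mapsto> (x (1 + \<i> s), 2 (s\<^sup>3 / 3 - s))\<close> of the Whitney immersion. Great circles are mapped to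
  horizontal curves of comparable length, which gives the upper bound. Conversely, a horizontal
  curve of length \<open>l\<close> moves \<open>z\<close> by at most \<open>l\<close> and \<open>t\<close> by at most \<open>2 (|z| + l) l\<close>. The
  \<open>z\<close>-coordinate alone separates points of the sphere up to a constant, except near the pair of poles,
  which the Whitney immersion identifies; there the \<open>t\<close>-coordinate separates them.
\<close>

section \<open>Absolutely continuous curves\<close>

text \<open>The definition indexes its intervals by an initial segment of the naturals. Transporting
  it along a bijection allows any finite index set, so that the tagged intervals of a division can
  serve as their own indices.\<close>

lemma absolutely_continuous_curve_sum_less:
  fixes f :: "real \<Rightarrow> 'a::metric_space"
  assumes "absolutely_continuous_curve a b f" and "\<epsilon> > 0"
  shows "\<exists>\<delta>>0. \<forall>(I::'i set) u v.
    finite I \<and> (\<forall>i\<in>I. a \<le> u i \<and> u i \<le> v i \<and> v i \<le> b) \<and>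
    disjoint_family_on (\<lambda>i. {u i<..<v i}) I \<and> (\<Sum>i\<in>I. v i - u i) < \<delta>
    \<longrightarrow> (\<Sum>i\<in>I. dist (f (u i)) (f (v i))) < \<epsilon>"
proof -
  obtain \<delta> where "\<delta> > 0" and \<delta>: "\<forall>(N::nat) u v. (\<forall>i<N. a \<le> u i \<and> u i \<le> v i \<and> v i \<le> b) \<and>
       (\<forall>i<N. \<forall>j<N. i \<noteq> j \<longrightarrow> {u i<..<v i} \<inter> {u j<..<v j} = {}) \<and>
       (\<Sum>i<N. v i - u i) < \<delta> \<longrightarrow> (\<Sum>i<N. dist (f (u i)) (f (v i))) < \<epsilon>"
    using assms unfolding absolutely_continuous_curve_def by blast
  show ?thesis
  proof (intro exI[of _ \<delta>] conjI allI impI, fact)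
    fix I :: "'i set" and u v
    assume I: "finite I \<and> (\<forall>i\<in>I. a \<le> u i \<and> u i \<le> v i \<and> v i \<le> b) \<and>
      disjoint_family_on (\<lambda>i. {u i<..<v i}) I \<and> (\<Sum>i\<in>I. v i - u i) < \<delta>"
    then obtain h where h: "bij_betw h {..<card I} I"
      using ex_bij_betw_nat_finite[of I] by (auto simp: atLeast0LessThan)
    have "(\<Sum>i<card I. dist (f (u (h i))) (f (v (h i)))) < \<epsilon>"
    proof (rule \<delta>[rule_format], intro conjI allI impI)
      fix i assume "i < card I"
      then have "h i \<in> I" using h by (auto simp: bij_betw_def)
      then show "a \<le> u (h i)" "u (h i) \<le> v (h i)" "v (h i) \<le> b" using I by auto
    next
      fix i j assume ij: "i < card I" "j < card I" "i \<noteq> j"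
      then have "h i \<in> I" "h j \<in> I" "h i \<noteq> h j"
        using h by (auto simp: bij_betw_def inj_on_def)
      then show "{u (h i)<..<v (h i)} \<inter> {u (h j)<..<v (h j)} = {}"
        using I unfolding disjoint_family_on_def by blast
    next
      show "(\<Sum>i<card I. v (h i) - u (h i)) < \<delta>"
        using I sum.reindex_bij_betw[OF h, of "\<lambda>i. v i - u i"] by simp
    qed
    then show "(\<Sum>i\<in>I. dist (f (u i)) (f (v i))) < \<epsilon>"
      using sum.reindex_bij_betw[OF h, of "\<lambda>i. dist (f (u i)) (f (v i))"] by simp
  qed
qed

text \<open>A Henstock-Kurzweil argument, which asks for no measurability or integrability of
  \<open>D\<close> in advance. A tagged division is split by whether the tag lies in
  \<open>N\<close>. Tags outside \<open>N\<close> are handled by differentiability; for tags in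
  \<open>N\<close> the increments of \<open>f\<close> are small in total by absolute
  continuity.\<close>

theorem fundamental_theorem_of_calculus_absolutely_continuous:
  fixes f :: "real \<Rightarrow> 'a::euclidean_space"
  assumes "a \<le> b" and ac: "absolutely_continuous_curve a b f" and "negligible N"
    and deriv: "\<And>x. x \<in> {a..b} - N \<Longrightarrow> (f has_vector_derivative D x) (at x within {a..b})"
  shows "(D has_integral (f b - f a)) {a..b}"
proof -
  \<comment> \<open>With value 0 on \<open>N\<close>, a tag in \<open>N\<close> contributes nothing
    to the Riemann sum, so its error is exactly an increment of \<open>f\<close>. The change back to
    \<open>D\<close> on a negligible set is made at the end.\<close>
  define D' where "D' x = (if x \<in> N then 0 else D x)" for x
  have "(D' has_integral (f b - f a)) {a..b}"
    unfolding has_integral_real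
  proof (intro allI impI)
    fix e :: real assume "e > 0"
    \<comment> \<open>The summand 1 keeps the denominator positive when \<open>a = b\<close> and
      makes \<open>e'le\<close> strict.\<close>
    define e' where "e' = e / (2 * (b - a + 1))"
    have "e' > 0" using \<open>e > 0\<close> \<open>a \<le> b\<close> by (simp add: e'_def)
    have e'le: "e' * (b - a) < e / 2"
      using \<open>e > 0\<close> \<open>a \<le> b\<close> by (simp add: e'_def field_simps)
    obtain \<delta> where "\<delta> > 0" and \<delta>: "\<forall>(I :: (real \<times> real set) set) u v.
        finite I \<and> (\<forall>i\<in>I. a \<le> u i \<and> u i \<le> v i \<and> v i \<le> b) \<and>
        disjoint_family_on (\<lambda>i. {u i<..<v i}) I \<and> (\<Sum>i\<in>I. v i - u i) < \<delta>
        \<longrightarrow> (\<Sum>i\<in>I. dist (f (u i)) (f (v i))) < e / 2"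
      using absolutely_continuous_curve_sum_less[OF ac half_gt_zero[OF \<open>e > 0\<close>]] by blast
    obtain T where T: "open T" "N \<subseteq> T" "emeasure lebesgue (T - N) < ennreal \<delta>"
      by (rule sets_lebesgue_outer_open[OF negligible_imp_sets[OF \<open>negligible N\<close>] \<open>\<delta> > 0\<close>])
    have NT: "N \<in> null_sets lebesgue"
      using \<open>negligible N\<close> negligible_iff_null_sets by blast
    have "T \<in> sets lebesgue" using \<open>open T\<close> by simp
    then have "emeasure lebesgue T < ennreal \<delta>"
      using T(3) emeasure_Diff_null_set[OF NT] by metis
    have "\<forall>x. \<exists>d>0. x \<in> {a..b} - N \<longrightarrow>
         (\<forall>y\<in>{a..b}. norm (y-x) < d \<longrightarrow> norm (f y - f x - (y-x) *\<^sub>R D x) \<le> e' * norm (y-x))"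
      using deriv[unfolded has_vector_derivative_def has_derivative_within_alt] \<open>e' > 0\<close>
      by (metis less_numeral_extra(1))
    then obtain d where d: "\<And>x. 0 < d x"
                 "\<And>x y. \<lbrakk>x \<in> {a..b} - N; y \<in> {a..b}; norm (y-x) < d x\<rbrakk>
                        \<Longrightarrow> norm (f y - f x - (y-x) *\<^sub>R D x) \<le> e' * norm (y-x)"
      by metis
    \<comment> \<open>The intervals tagged in \<open>N\<close> lie in \<open>T\<close>, so their total length is below \<open>\<delta>\<close>.\<close>
    define G where "G x = (if x \<in> N then T else ball x (d x))" for x
    have gauge: "gauge G"
      using T d(1) by (auto simp: gauge_def G_def)
    have sum: "norm ((\<Sum>(x,K)\<in>p. measure lborel K *\<^sub>R D' x) - (f b - f a)) < e"
      if p: "p tagged_division_of {a..b}" "G fine p" for p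
    proof -
      have "finite p" using p(1) by auto
      define P where "P = {xK \<in> p. fst xK \<in> N}"
      have ivl: "\<exists>u v. K = {u..v} \<and> u \<le> v \<and> a \<le> u \<and> v \<le> b \<and> u \<le> x \<and> x \<le> v" if xK: "(x, K) \<in> p" for x K
      proof -
        obtain u v where "K = cbox u v" using tagged_division_ofD(4)[OF p(1) xK] by blast
        moreover have "x \<in> K" "K \<subseteq> {a..b}" using p(1) xK by blast+
        ultimately show ?thesis by (auto intro!: exI[of _ u] exI[of _ v])
      qed
      have ba: "b - a = (\<Sum>(x,K)\<in>p. Sup K - Inf K)" "f b - f a = (\<Sum>(x,K)\<in>p. f (Sup K) - f (Inf K))"
        using additive_tagged_division_1[where f= "\<lambda>x. x", OF \<open>a \<le> b\<close> p(1)]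
          additive_tagged_division_1[where f= f, OF \<open>a \<le> b\<close> p(1)] by auto
      have Sup_Inf: "a \<le> Inf K \<and> Inf K \<le> Sup K \<and> Sup K \<le> b \<and> K = {Inf K..Sup K}" if "(x, K) \<in> p" for x K
        using ivl[OF that] by auto
      have "P \<subseteq> p" by (auto simp: P_def)
      have disj: "disjoint_family_on (\<lambda>i. {Inf (snd i)<..<Sup (snd i)}) P"
        unfolding disjoint_family_on_def
      proof (intro ballI impI)
        fix i j assume ij: "i \<in> P" "j \<in> P" "i \<noteq> j"
        obtain x K y L where xy: "i = (x, K)" "j = (y, L)" by fastforce
        have "interior K \<inter> interior L = {}"
          using tagged_division_ofD(5)[OF p(1), of x K y L] ij xy \<open>P \<subseteq> p\<close> by auto
        moreover have "interior K = {Inf K<..<Sup K}" "interior L = {Inf L<..<Sup L}"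
          using Sup_Inf[of x K] Sup_Inf[of y L] ij xy \<open>P \<subseteq> p\<close> interior_atLeastAtMost_real
          by (metis subsetD)+
        ultimately show "{Inf (snd i)<..<Sup (snd i)} \<inter> {Inf (snd j)<..<Sup (snd j)} = {}"
          by (simp add: xy)
      qed
      have small: "(\<Sum>i\<in>P. Sup (snd i) - Inf (snd i)) < \<delta>"
      proof -
        have "(\<Sum>i\<in>P. emeasure lebesgue {Inf (snd i)<..<Sup (snd i)})
              = emeasure lebesgue (\<Union>i\<in>P. {Inf (snd i)<..<Sup (snd i)})"
          using \<open>finite p\<close> \<open>P \<subseteq> p\<close> disj by (intro sum_emeasure) (auto intro: finite_subset)
        also have "\<dots> \<le> emeasure lebesgue T"
        proof (rule emeasure_mono)
          show "(\<Union>i\<in>P. {Inf (snd i)<..<Sup (snd i)}) \<subseteq> T"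
          proof clarify
            fix x K t assume "(x, K) \<in> P" and t: "t \<in> {Inf (snd (x,K))<..<Sup (snd (x,K))}"
            then have xK: "(x, K) \<in> p" "x \<in> N" by (auto simp: P_def)
            then have "K \<subseteq> T" using fineD[OF p(2) xK(1)] by (simp add: G_def)
            moreover have "t \<in> K"
            proof -
              have "t \<in> {Inf K..Sup K}" using t by auto
              then show ?thesis using Sup_Inf[OF xK(1)] by metis
            qed
            ultimately show "t \<in> T" by blast
          qed
        qed fact
        also have "\<dots> < ennreal \<delta>" by fact
        finally have "(\<Sum>i\<in>P. emeasure lebesgue {Inf (snd i)<..<Sup (snd i)}) < ennreal \<delta>" .
        also have "(\<Sum>i\<in>P. emeasure lebesgue {Inf (snd i)<..<Sup (snd i)}) =
                   (\<Sum>i\<in>P. ennreal (Sup (snd i) - Inf (snd i)))"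
          using Sup_Inf \<open>P \<subseteq> p\<close> by (intro sum.cong) auto
        also have "\<dots> = ennreal (\<Sum>i\<in>P. Sup (snd i) - Inf (snd i))"
          using Sup_Inf \<open>P \<subseteq> p\<close> by (intro sum_ennreal) auto
        finally have "ennreal (\<Sum>i\<in>P. Sup (snd i) - Inf (snd i)) < ennreal \<delta>" .
        moreover have "0 \<le> (\<Sum>i\<in>P. Sup (snd i) - Inf (snd i))"
          using Sup_Inf \<open>P \<subseteq> p\<close> by (intro sum_nonneg) auto
        ultimately show ?thesis by (simp add: ennreal_less_iff)
      qed
      have bad: "(\<Sum>i\<in>P. dist (f (Inf (snd i))) (f (Sup (snd i)))) < e / 2"
        using Sup_Inf \<open>P \<subseteq> p\<close> \<open>finite p\<close> disj small
        by (intro \<delta>[rule_format] conjI ballI) (auto intro: finite_subset)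
      \<comment> \<open>The tag lies between the endpoints of \<open>K\<close>, so the two
        differentiability errors, measured from the tag to each endpoint, add up to
        \<open>e'\<close> times the length of \<open>K\<close>.\<close>
      have good: "norm (measure lborel K *\<^sub>R D' x - (f (Sup K) - f (Inf K))) \<le> e' * (Sup K - Inf K)"
        if "(x, K) \<in> p - P" for x K
      proof -
        have xK: "(x, K) \<in> p" "x \<notin> N" using that by (auto simp: P_def)
        then obtain u v where uv: "K = {u..v}" "u \<le> v" "a \<le> u" "v \<le> b" "u \<le> x" "x \<le> v"
          using ivl by blast
        have "K \<subseteq> ball x (d x)" using fineD[OF p(2) xK(1)] xK(2) by (simp add: G_def)
        moreover have "u \<in> K" "v \<in> K" using uv by auto
        ultimately have "u \<in> ball x (d x)" "v \<in> ball x (d x)" by blast+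
        then have *: "norm (f u - f x - (u-x) *\<^sub>R D x) \<le> e' * norm (u-x)"
          "norm (f v - f x - (v-x) *\<^sub>R D x) \<le> e' * norm (v-x)"
          using d(2)[of x u] d(2)[of x v] uv xK(2) by (auto simp: dist_norm norm_minus_commute)
        have "norm (measure lborel K *\<^sub>R D' x - (f (Sup K) - f (Inf K)))
            = norm ((f u - f x - (u-x) *\<^sub>R D x) - (f v - f x - (v-x) *\<^sub>R D x))"
          using uv xK(2) by (simp add: D'_def algebra_simps)
        also have "\<dots> \<le> e' * norm (u-x) + e' * norm (v-x)"
          using * norm_triangle_ineq4 by (smt (verit, best))
        also have "\<dots> = e' * (Sup K - Inf K)"
          using uv by (simp add: algebra_simps)
        finally show ?thesis .
      qed
      have "norm ((\<Sum>(x,K)\<in>p. measure lborel K *\<^sub>R D' x) - (f b - f a))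
          = norm (\<Sum>(x,K)\<in>p. measure lborel K *\<^sub>R D' x - (f (Sup K) - f (Inf K)))"
        by (simp add: ba(2) sum_subtractf split_def)
      also have "(\<Sum>(x,K)\<in>p. measure lborel K *\<^sub>R D' x - (f (Sup K) - f (Inf K))) =
        (\<Sum>(x,K)\<in>p - P. measure lborel K *\<^sub>R D' x - (f (Sup K) - f (Inf K)))
         + (\<Sum>(x,K)\<in>P. measure lborel K *\<^sub>R D' x - (f (Sup K) - f (Inf K)))"
        by (rule sum.subset_diff) fact+
      \<comment> \<open>The sum over \<open>P\<close> is bounded by the increments of
        \<open>f\<close> alone because \<open>D'\<close> vanishes at its tags.\<close>
      also have "norm \<dots> \<le> (\<Sum>(x,K)\<in>p - P. e' * (Sup K - Inf K))
          + (\<Sum>i\<in>P. dist (f (Inf (snd i))) (f (Sup (snd i))))"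
        using good
        by (intro order_trans[OF norm_triangle_ineq] add_mono sum_norm_le)
          (auto simp: P_def D'_def dist_norm norm_minus_commute)
      also have "(\<Sum>(x,K)\<in>p - P. e' * (Sup K - Inf K)) \<le> (\<Sum>(x,K)\<in>p. e' * (Sup K - Inf K))"
        using \<open>finite p\<close> \<open>e' > 0\<close> Sup_Inf by (intro sum_mono2) auto
      also have "\<dots> = e' * (b - a)"
        by (simp add: ba(1) sum_distrib_left split_def)
      finally show ?thesis using bad e'le by linarith
    qed
    show "\<exists>\<gamma>. gauge \<gamma> \<and> (\<forall>\<D>. \<D> tagged_division_of {a..b} \<and> \<gamma> fine \<D> \<longrightarrow>
        norm ((\<Sum>(x,k)\<in>\<D>. measure lborel k *\<^sub>R D' x) - (f b - f a)) < e)"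
      by (intro exI[of _ G] conjI gauge allI impI sum) auto
  qed
  then show ?thesis
    by (rule has_integral_spike[OF \<open>negligible N\<close>, rotated]) (auto simp: D'_def)
qed

lemma absolutely_continuous_curve_AE_has_integral:
  fixes f :: "real \<Rightarrow> 'a::euclidean_space"
  assumes "a \<le> b" and ac: "absolutely_continuous_curve a b f"
    and deriv: "AE t in lebesgue. t \<in> {a..b} \<longrightarrow> (f has_vector_derivative D t) (at t)"
  shows "(D has_integral (f b - f a)) {a..b}"
proof -
  obtain N where N: "N \<in> null_sets lebesgue"
    "{t \<in> space lebesgue. \<not> (t \<in> {a..b} \<longrightarrow> (f has_vector_derivative D t) (at t))} \<subseteq> N"
    using deriv unfolding eventually_ae_filter by auto
  have "negligible N" using N(1) negligible_iff_null_sets by blast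
  then show ?thesis
    using N(2) by (intro fundamental_theorem_of_calculus_absolutely_continuous[OF \<open>a \<le> b\<close> ac])
      (auto intro: has_vector_derivative_at_within)
qed

text \<open>The Henstock-Kurzweil integral of \<open>D\<close> already makes \<open>D\<close>
  measurable on the interval. Together with the finite bound \<open>l\<close> this yields Lebesgue
  integrability, and the norm of the integral is at most the integral of the norm.\<close>

lemma absolutely_continuous_curve_norm_diff_le:
  fixes f :: "real \<Rightarrow> 'a::euclidean_space"
  assumes "a \<le> b" and ac: "absolutely_continuous_curve a b f"
    and deriv: "AE t in lebesgue. t \<in> {a..b} \<longrightarrow> (f has_vector_derivative D t) (at t)"
    and length: "(\<integral>\<^sup>+t\<in>{a..b}. ennreal (norm (D t)) \<partial>lebesgue) \<le> ennreal l" and "0 \<le> l"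
  shows "norm (f b - f a) \<le> l"
proof -
  note D = absolutely_continuous_curve_AE_has_integral[OF \<open>a \<le> b\<close> ac deriv]
  have le: "(\<integral>\<^sup>+t. ennreal (norm (indicator {a..b} t *\<^sub>R D t)) \<partial>lebesgue) \<le> ennreal l"
    by (rule order_trans[OF _ length]) (auto intro!: nn_integral_mono simp: indicator_def)
  have int: "integrable lebesgue (\<lambda>t. indicator {a..b} t *\<^sub>R D t)"
    using has_integral_implies_lebesgue_measurable[OF D] le
    by (intro integrableI_bounded) (auto intro: le_less_trans)
  then have "D absolutely_integrable_on {a..b}" by (simp add: set_integrable_def)
  then have "f b - f a = (LINT t:{a..b}|lebesgue. D t)"
    using D set_lebesgue_integral_eq_integral(2) integral_unique by metis
  also have "ennreal (norm \<dots>) \<le> (\<integral>\<^sup>+t. ennreal (norm (indicator {a..b} t *\<^sub>R D t)) \<partial>lebesgue)"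
    unfolding set_lebesgue_integral_def by (rule integral_norm_bound_ennreal[OF int])
  also note le
  finally show ?thesis using \<open>0 \<le> l\<close> by simp
qed

section \<open>Horizontal vectors and curves\<close>

text \<open>The equation says that \<open>v\<close> lies in the kernel of the contact form dt - 2
  sum (y_j dx_j - x_j dy_j). This kernel is a subspace containing all \<open>heis_X j p\<close> and
  \<open>heis_Y j p\<close>; conversely, a vector in it is the combination of these fields whose
  coefficients are the real and imaginary parts of its first component. These coefficients also give
  the norm.\<close>

lemma horizontal_space_iff:
  fixes p v :: "'n::finite heis"
  shows "v \<in> horizontal_space p \<longleftrightarrow>
    snd v = 2 * (\<Sum>j\<in>UNIV. Im (fst p $ j) * Re (fst v $ j) - Re (fst p $ j) * Im (fst v $ j))"
    (is "_ \<longleftrightarrow> ?H v")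
  and horizontal_norm_eq_norm: "v \<in> horizontal_space p \<Longrightarrow> horizontal_norm p v = norm (fst v)"
proof -
  have frame: "v = (\<Sum>j\<in>UNIV. Re (fst v $ j) *\<^sub>R heis_X j p + Im (fst v $ j) *\<^sub>R heis_Y j p)" (is "_ = ?S")
    if "?H v"
  proof -
    have "fst v = fst ?S"
      unfolding vec_eq_iff
    proof
      fix i
      have "fst ?S $ i = (\<Sum>j\<in>UNIV. if j = i then fst v $ j else 0)"
        unfolding fst_sum sum_component
        by (intro sum.cong refl) (auto simp: heis_X_def heis_Y_def axis_def complex_eq_iff)
      then show "fst v $ i = fst ?S $ i" by simp
    qed
    moreover have "snd v = snd ?S"
      unfolding that snd_sum sum_distrib_left
      by (intro sum.cong refl) (simp add: heis_X_def heis_Y_def algebra_simps)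
    ultimately show ?thesis by (rule prod_eqI)
  qed
  have "linear (\<lambda>v::'n heis. snd v -
      2 * (\<Sum>j\<in>UNIV. Im (fst p $ j) * Re (fst v $ j) - Re (fst p $ j) * Im (fst v $ j)))"
    by (rule linearI) (simp_all add: sum.distrib sum_subtractf algebra_simps sum_distrib_left)
  from linear_subspace_kernel[OF this] have "subspace {v. ?H v}"
    by simp
  moreover have "?H (heis_X j p)" "?H (heis_Y j p)" for j
    by (simp_all add: heis_X_def heis_Y_def axis_def if_distrib if_distribR sum.delta sum_subtractf cong: if_cong)
  ultimately have "horizontal_space p \<subseteq> {v. ?H v}"
    unfolding horizontal_space_def by (intro span_minimal) auto
  then have H: "?H v" if "v \<in> horizontal_space p"
    using that by blast
  show "v \<in> horizontal_space p \<longleftrightarrow> ?H v"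
  proof
    assume "?H v"
    then have "v = (\<Sum>j\<in>UNIV. Re (fst v $ j) *\<^sub>R heis_X j p + Im (fst v $ j) *\<^sub>R heis_Y j p)"
      by (rule frame)
    also have "\<dots> \<in> horizontal_space p"
      unfolding horizontal_space_def
      by (intro span_sum span_add span_scale) (auto intro: span_base)
    finally show "v \<in> horizontal_space p" .
  qed (rule H)
  show "horizontal_norm p v = norm (fst v)" if "v \<in> horizontal_space p"
  proof -
    have "horizontal_norm p v = sqrt (\<Sum>j\<in>UNIV. (Re (fst v $ j))\<^sup>2 + (Im (fst v $ j))\<^sup>2)"
      using horizontal_norm_eq[of p "\<lambda>j. Re (fst v $ j)" "\<lambda>j. Im (fst v $ j)"]
        frame[OF H[OF that]] by simp
    then show ?thesis
      by (simp add: norm_vec_def L2_set_def cmod_power2)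
  qed
qed

text \<open>Cauchy-Schwarz, since each summand is the imaginary part of
  \<open>z $ j * cnj (w $ j)\<close>. Through \<open>horizontal_space_iff\<close> it bounds the
  t-speed of a horizontal curve by 2 |z| |z'|.\<close>

lemma sum_Im_mult_cnj_le:
  fixes z w :: "complex ^ 'n::finite"
  shows "\<bar>\<Sum>j\<in>UNIV. Im (z $ j) * Re (w $ j) - Re (z $ j) * Im (w $ j)\<bar> \<le> norm z * norm w"
proof -
  have "\<bar>\<Sum>j\<in>UNIV. Im (z $ j) * Re (w $ j) - Re (z $ j) * Im (w $ j)\<bar>
      \<le> (\<Sum>j\<in>UNIV. \<bar>norm (z $ j)\<bar> * \<bar>norm (w $ j)\<bar>)"
  proof (intro order_trans[OF sum_abs] sum_mono)
    fix j
    have "Im (z $ j) * Re (w $ j) - Re (z $ j) * Im (w $ j) = Im (z $ j * cnj (w $ j))"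
      by simp
    also have "\<bar>\<dots>\<bar> \<le> norm (z $ j * cnj (w $ j))"
      by (rule abs_Im_le_cmod)
    finally show "\<bar>Im (z $ j) * Re (w $ j) - Re (z $ j) * Im (w $ j)\<bar> \<le> \<bar>norm (z $ j)\<bar> * \<bar>norm (w $ j)\<bar>"
      by (simp add: norm_mult)
  qed
  also have "\<dots> \<le> norm z * norm w"
    unfolding norm_vec_def by (rule L2_set_mult_ineq)
  finally show ?thesis .
qed

section \<open>Displacement estimates along horizontal curves\<close>

lemma absolutely_continuous_curve_mono:
  assumes "absolutely_continuous_curve a b f" "a \<le> c" "d \<le> b"
    and "\<And>x y. x \<in> {a..b} \<Longrightarrow> y \<in> {a..b} \<Longrightarrow> dist (g x) (g y) \<le> dist (f x) (f y)"
  shows "absolutely_continuous_curve c d g"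
  unfolding absolutely_continuous_curve_def
proof (intro allI impI)
  fix e :: real assume "e > 0"
  then obtain \<delta> where "\<delta> > 0" and \<delta>: "\<forall>(N::nat) u v. (\<forall>i<N. a \<le> u i \<and> u i \<le> v i \<and> v i \<le> b) \<and>
       (\<forall>i<N. \<forall>j<N. i \<noteq> j \<longrightarrow> {u i<..<v i} \<inter> {u j<..<v j} = {}) \<and>
       (\<Sum>i<N. v i - u i) < \<delta> \<longrightarrow> (\<Sum>i<N. dist (f (u i)) (f (v i))) < e"
    using assms(1) unfolding absolutely_continuous_curve_def by blast
  show "\<exists>\<delta>>0. \<forall>(N::nat) u v. (\<forall>i<N. c \<le> u i \<and> u i \<le> v i \<and> v i \<le> d) \<and>
       (\<forall>i<N. \<forall>j<N. i \<noteq> j \<longrightarrow> {u i<..<v i} \<inter> {u j<..<v j} = {}) \<and>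
       (\<Sum>i<N. v i - u i) < \<delta> \<longrightarrow> (\<Sum>i<N. dist (g (u i)) (g (v i))) < e"
  proof (intro exI[of _ \<delta>] conjI allI impI, fact, elim conjE)
    fix N :: nat and u v
    assume *: "\<forall>i<N. c \<le> u i \<and> u i \<le> v i \<and> v i \<le> d"
       "\<forall>i<N. \<forall>j<N. i \<noteq> j \<longrightarrow> {u i<..<v i} \<inter> {u j<..<v j} = {}" "(\<Sum>i<N. v i - u i) < \<delta>"
    have uv: "a \<le> u i \<and> u i \<le> v i \<and> v i \<le> b" if "i < N" for i
      using *(1) that assms(2,3) by force
    have "(\<Sum>i<N. dist (g (u i)) (g (v i))) \<le> (\<Sum>i<N. dist (f (u i)) (f (v i)))"
      using uv by (intro sum_mono assms(4)) force+
    also have "\<dots> < e"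
      using \<delta> uv *(2,3) by blast
    finally show "(\<Sum>i<N. dist (g (u i)) (g (v i))) < e" .
  qed
qed

lemma lipschitz_imp_absolutely_continuous_curve:
  assumes "\<And>x y. x \<in> {a..b} \<Longrightarrow> y \<in> {a..b} \<Longrightarrow> dist (f x) (f y) \<le> C * \<bar>x - y\<bar>" "C > 0"
  shows "absolutely_continuous_curve a b f"
  unfolding absolutely_continuous_curve_def
proof (intro allI impI)
  fix e :: real assume "e > 0"
  show "\<exists>\<delta>>0. \<forall>(N::nat) u v. (\<forall>i<N. a \<le> u i \<and> u i \<le> v i \<and> v i \<le> b) \<and>
       (\<forall>i<N. \<forall>j<N. i \<noteq> j \<longrightarrow> {u i<..<v i} \<inter> {u j<..<v j} = {}) \<and>
       (\<Sum>i<N. v i - u i) < \<delta> \<longrightarrow> (\<Sum>i<N. dist (f (u i)) (f (v i))) < e"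
  proof (intro exI[of _ "e / C"] conjI allI impI, use \<open>e > 0\<close> \<open>C > 0\<close> in simp, elim conjE)
    fix N :: nat and u v
    assume *: "\<forall>i<N. a \<le> u i \<and> u i \<le> v i \<and> v i \<le> b" "(\<Sum>i<N. v i - u i) < e / C"
    have "dist (f (u i)) (f (v i)) \<le> C * (v i - u i)" if "i < N" for i
      using assms(1)[of "u i" "v i"] *(1) that by force
    then have "(\<Sum>i<N. dist (f (u i)) (f (v i))) \<le> C * (\<Sum>i<N. v i - u i)"
      unfolding sum_distrib_left by (intro sum_mono) auto
    also have "\<dots> < e"
      using *(2) \<open>C > 0\<close> by (simp add: field_simps)
    finally show "(\<Sum>i<N. dist (f (u i)) (f (v i))) < e" .
  qed
qed

text \<open>The horizontal speed is |z'|, so z never moves further than \<open>l\<close> from its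
  start. Hence |z| is bounded along the whole curve, the t-speed is at most a constant times |z'|,
  and a second integration gives the bound on t.\<close>

lemma horizontal_curve_diff_le:
  fixes \<gamma> :: "real \<Rightarrow> 'n::finite heis"
  assumes "a \<le> b" and \<gamma>: "horizontal_curve a b \<gamma>" and len: "horizontal_length a b \<gamma> \<le> ennreal l" and "0 \<le> l"
  shows "norm (fst (\<gamma> b) - fst (\<gamma> a)) \<le> l"
    and "\<bar>snd (\<gamma> b) - snd (\<gamma> a)\<bar> \<le> 2 * (norm (fst (\<gamma> a)) + l) * l"
proof -
  define D where "D t = vector_derivative \<gamma> (at t)" for t
  have ac: "absolutely_continuous_curve a b \<gamma>" using \<gamma> by (simp add: horizontal_curve_def)
  have ae: "AE t in lebesgue. t \<in> {a..b} \<longrightarrow>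
     (\<gamma> has_vector_derivative D t) (at t) \<and> D t \<in> horizontal_space (\<gamma> t)"
    using \<gamma> unfolding horizontal_curve_def D_def by (auto simp: vector_derivative_works)
  \<comment> \<open>\<open>horizontal_norm\<close> is unspecified off the horizontal space, so the
    two integrands agree only almost everywhere.\<close>
  have "(\<integral>\<^sup>+t\<in>{a..b}. ennreal (norm (fst (D t))) \<partial>lebesgue) = horizontal_length a b \<gamma>"
    unfolding horizontal_length_def D_def[symmetric]
    using ae by (intro nn_integral_cong_AE) (auto simp: horizontal_norm_eq_norm indicator_def elim!: eventually_mono)
  then have len': "(\<integral>\<^sup>+t\<in>{a..b}. ennreal (norm (fst (D t))) \<partial>lebesgue) \<le> ennreal l"
    using len by simp
  \<comment> \<open>An arbitrary end time \<open>c\<close> is allowed because the t-estimate needs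
    |z| bounded at every time, not only at \<open>b\<close>.\<close>
  have fst_ac: "absolutely_continuous_curve a c (\<lambda>t. fst (\<gamma> t))" if "c \<in> {a..b}" for c
    using that by (intro absolutely_continuous_curve_mono[OF ac]) (auto intro: dist_fst_le)
  have fst_deriv: "AE t in lebesgue. t \<in> {a..c} \<longrightarrow> ((\<lambda>t. fst (\<gamma> t)) has_vector_derivative fst (D t)) (at t)"
    if "c \<in> {a..b}" for c
    using ae that by (auto intro!: bounded_linear.has_vector_derivative[OF bounded_linear_fst] elim!: eventually_mono)
  have fst_le: "norm (fst (\<gamma> c) - fst (\<gamma> a)) \<le> l" if c: "c \<in> {a..b}" for c
  proof (rule absolutely_continuous_curve_norm_diff_le[where f = "\<lambda>t. fst (\<gamma> t)" and D = "\<lambda>t. fst (D t)"])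
    show "(\<integral>\<^sup>+t\<in>{a..c}. ennreal (norm (fst (D t))) \<partial>lebesgue) \<le> ennreal l"
      using c by (intro order_trans[OF _ len'] nn_integral_mono) (auto simp: indicator_def)
  qed (use c \<open>0 \<le> l\<close> fst_ac fst_deriv in auto)
  then show "norm (fst (\<gamma> b) - fst (\<gamma> a)) \<le> l" using \<open>a \<le> b\<close> by simp
  define R where "R = norm (fst (\<gamma> a)) + l"
  have "R \<ge> 0" using \<open>0 \<le> l\<close> by (simp add: R_def)
  have bound: "norm (fst (\<gamma> t)) \<le> R" if "t \<in> {a..b}" for t
    using fst_le[OF that] norm_triangle_sub[of "fst (\<gamma> t)" "fst (\<gamma> a)"] by (simp add: R_def)
  have "norm (snd (\<gamma> b) - snd (\<gamma> a)) \<le> 2 * R * l"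
  proof (rule absolutely_continuous_curve_norm_diff_le[where f = "\<lambda>t. snd (\<gamma> t)" and D = "\<lambda>t. snd (D t)"])
    show "absolutely_continuous_curve a b (\<lambda>t. snd (\<gamma> t))"
      by (intro absolutely_continuous_curve_mono[OF ac]) (auto intro: dist_snd_le)
    show "AE t in lebesgue. t \<in> {a..b} \<longrightarrow> ((\<lambda>t. snd (\<gamma> t)) has_vector_derivative snd (D t)) (at t)"
      using ae by (auto intro!: bounded_linear.has_vector_derivative[OF bounded_linear_snd] elim!: eventually_mono)
    have pt: "norm (snd (D t)) \<le> 2 * R * norm (fst (D t))" if "t \<in> {a..b}" "D t \<in> horizontal_space (\<gamma> t)" for t
    proof -
      have "norm (snd (D t)) \<le> 2 * (norm (fst (\<gamma> t)) * norm (fst (D t)))"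
        using that(2) sum_Im_mult_cnj_le[of "fst (\<gamma> t)" "fst (D t)"]
        unfolding horizontal_space_iff by (simp add: abs_mult)
      also have "\<dots> \<le> 2 * (R * norm (fst (D t)))"
        using bound[OF that(1)] by (intro mult_left_mono mult_right_mono) auto
      finally show ?thesis by simp
    qed
    have "(\<integral>\<^sup>+t\<in>{a..b}. ennreal (norm (snd (D t))) \<partial>lebesgue)
        \<le> (\<integral>\<^sup>+t. ennreal (2 * R) * (ennreal (norm (fst (D t))) * indicator {a..b} t) \<partial>lebesgue)"
      using ae
    proof (intro nn_integral_mono_AE, elim eventually_mono)
      fix t assume t: "t \<in> {a..b} \<longrightarrow>
        (\<gamma> has_vector_derivative D t) (at t) \<and> D t \<in> horizontal_space (\<gamma> t)"
      show "ennreal (norm (snd (D t))) * indicator {a..b} t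
        \<le> ennreal (2 * R) * (ennreal (norm (fst (D t))) * indicator {a..b} t)"
        using pt[of t] t \<open>R \<ge> 0\<close> by (auto simp: indicator_def simp flip: ennreal_mult')
    qed
    also have "\<dots> \<le> ennreal (2 * R) * (\<integral>\<^sup>+t\<in>{a..b}. ennreal (norm (fst (D t))) \<partial>lebesgue)"
    proof -
      \<comment> \<open>Pulling the constant out of the nonnegative integral requires measurability
        of |z'|, which comes from the Henstock-Kurzweil integral of z'.\<close>
      have "(\<lambda>t. indicator {a..b} t *\<^sub>R fst (D t)) \<in> borel_measurable lebesgue"
        using \<open>a \<le> b\<close>
        by (intro has_integral_implies_lebesgue_measurable[OF absolutely_continuous_curve_AE_has_integral[where f = "\<lambda>t. fst (\<gamma> t)"]]
            fst_ac fst_deriv) auto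
      then have "(\<lambda>t. ennreal (norm (indicator {a..b} t *\<^sub>R fst (D t)))) \<in> borel_measurable lebesgue"
        by measurable
      also have "(\<lambda>t. ennreal (norm (indicator {a..b} t *\<^sub>R fst (D t)))) =
          (\<lambda>t. ennreal (norm (fst (D t))) * indicator {a..b} t)"
        by (auto simp: indicator_def fun_eq_iff)
      finally show ?thesis by (simp add: nn_integral_cmult)
    qed
    also have "\<dots> \<le> ennreal (2 * R) * ennreal l"
      using len' by (rule mult_left_mono) simp
    also have "\<dots> = ennreal (2 * R * l)"
      using \<open>R \<ge> 0\<close> by (simp flip: ennreal_mult')
    finally show "(\<integral>\<^sup>+t\<in>{a..b}. ennreal (norm (snd (D t))) \<partial>lebesgue) \<le> ennreal (2 * R * l)" .
  qed (use \<open>a \<le> b\<close> \<open>R \<ge> 0\<close> \<open>0 \<le> l\<close> in auto)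
  then show "\<bar>snd (\<gamma> b) - snd (\<gamma> a)\<bar> \<le> 2 * (norm (fst (\<gamma> a)) + l) * l"
    by (simp add: R_def)
qed

section \<open>The Legendrian Whitney sphere\<close>

definition complex_vec :: "(real ^ 'n) \<times> (real ^ 'n) \<Rightarrow> complex ^ 'n::finite" where
  "complex_vec p = (\<chi> j. Complex (fst p $ j) (snd p $ j))"

lemma bounded_linear_complex_vec: "bounded_linear (complex_vec :: _ \<Rightarrow> complex ^ 'n::finite)"
  by (rule linear_conv_bounded_linear[THEN iffD1], rule linearI)
     (auto simp: complex_vec_def vec_eq_iff complex_eq_iff)

lemma norm_complex_vec: "norm (complex_vec p :: complex ^ 'n::finite) = norm p"
  by (simp add: complex_vec_def norm_vec_def L2_set_def cmod_power2 sum.distrib norm_prod_def sum_nonneg)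

text \<open>For z = x (1 + i s) horizontality demands dt = -2 |x|^2 ds. On the unit sphere this is 2
  (s^2 - 1) ds, and the last coordinate is its primitive vanishing at s = 0.\<close>

definition whitney :: "(real ^ 'n) \<times> real \<Rightarrow> 'n::finite heis" where
  "whitney p = (complex_vec (fst p, snd p *\<^sub>R fst p), 2 * (snd p ^ 3 / 3 - snd p))"

text \<open>A crude uniform bound that replaces the starting value of |z| in the t-estimate of
  \<open>horizontal_curve_diff_le\<close> by a constant.\<close>

lemma norm_fst_whitney_le:
  assumes "norm p = 1"
  shows "norm (fst (whitney p)) \<le> 2"
proof -
  have "\<bar>snd p\<bar> \<le> 1" "norm (fst p) \<le> 1"
    using norm_snd_le[of "snd p" "fst p"] norm_fst_le[of "fst p" "snd p"] assms by auto
  then have "norm (fst p) + \<bar>snd p\<bar> * norm (fst p) \<le> 1 + 1 * 1"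
    by (intro add_mono mult_mono) auto
  then show ?thesis
    using norm_Pair_le[of "fst p" "snd p *\<^sub>R fst p"] by (simp add: whitney_def norm_complex_vec)
qed

definition whitney_deriv :: "(real ^ 'n) \<times> real \<Rightarrow> (real ^ 'n) \<times> real \<Rightarrow> 'n::finite heis" where
  "whitney_deriv p v = (complex_vec (fst v, snd p *\<^sub>R fst v + snd v *\<^sub>R fst p), 2 * ((snd p)\<^sup>2 - 1) * snd v)"

lemma whitney_has_vector_derivative:
  assumes "(c has_vector_derivative v) (at t)"
  shows "((\<lambda>t. whitney (c t)) has_vector_derivative whitney_deriv (c t) v) (at t)"
proof -
  have x: "((\<lambda>t. fst (c t)) has_vector_derivative fst v) (at t)"
    by (rule bounded_linear.has_vector_derivative[OF bounded_linear_fst assms])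
  have s: "((\<lambda>t. snd (c t)) has_real_derivative snd v) (at t)"
    unfolding has_real_derivative_iff_has_vector_derivative
    by (rule bounded_linear.has_vector_derivative[OF bounded_linear_snd assms])
  have "((\<lambda>t. (fst (c t), snd (c t) *\<^sub>R fst (c t))) has_vector_derivative
      (fst v, snd (c t) *\<^sub>R fst v + snd v *\<^sub>R fst (c t))) (at t)"
    by (intro has_vector_derivative_Pair has_vector_derivative_scaleR x s)
  from bounded_linear.has_vector_derivative[OF bounded_linear_complex_vec this]
  have 1: "((\<lambda>t. complex_vec (fst (c t), snd (c t) *\<^sub>R fst (c t))) has_vector_derivative
      complex_vec (fst v, snd (c t) *\<^sub>R fst v + snd v *\<^sub>R fst (c t))) (at t)" .
  have "((\<lambda>t. 2 * (snd (c t) ^ 3 / 3 - snd (c t))) has_real_derivative 2 * ((snd (c t))\<^sup>2 - 1) * snd v) (at t)"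
    by (rule derivative_eq_intros s refl | simp add: algebra_simps power2_eq_square)+
  then have 2: "((\<lambda>t. 2 * (snd (c t) ^ 3 / 3 - snd (c t))) has_vector_derivative 2 * ((snd (c t))\<^sup>2 - 1) * snd v) (at t)"
    unfolding has_real_derivative_iff_has_vector_derivative .
  show ?thesis
    unfolding whitney_def whitney_deriv_def by (intro has_vector_derivative_Pair 1 2)
qed

text \<open>In the contact form the terms with the inner product of x and dx cancel, leaving -2
  |x|^2 ds to be matched with the last component 2 (s^2 - 1) ds. The two agree because |x|^2 + s^2 =
  1.\<close>

lemma whitney_deriv_horizontal:
  assumes "norm p = 1"
  shows "whitney_deriv p v \<in> horizontal_space (whitney p)"
proof -
  have "(norm (fst p))\<^sup>2 + (snd p)\<^sup>2 = 1"
    using assms by (simp add: norm_prod_def)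
  then have *: "(snd p)\<^sup>2 - 1 = - (\<Sum>j\<in>UNIV. fst p $ j * fst p $ j)"
    unfolding power2_norm_eq_inner inner_vec_def by simp
  show ?thesis
    unfolding horizontal_space_iff whitney_deriv_def snd_conv *
    by (simp add: whitney_def complex_vec_def algebra_simps sum_distrib_left flip: sum_negf)
qed

text \<open>The bound 3 controls the horizontal length of the image of a great circle. The bound 5 =
  3 + 2 is for the full Euclidean speed and gives the Lipschitz property behind absolute
  continuity.\<close>

lemma norm_whitney_deriv_le:
  assumes "norm p = 1" "norm v = 1"
  shows "norm (fst (whitney_deriv p v)) \<le> 3" "norm (whitney_deriv p v) \<le> 5"
proof -
  have b: "\<bar>snd p\<bar> \<le> 1" "norm (fst p) \<le> 1" "\<bar>snd v\<bar> \<le> 1" "norm (fst v) \<le> 1"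
    using norm_snd_le[of "snd p" "fst p"] norm_fst_le[of "fst p" "snd p"]
      norm_snd_le[of "snd v" "fst v"] norm_fst_le[of "fst v" "snd v"] assms by auto
  have "norm (fst (whitney_deriv p v)) \<le> norm (fst v) + norm (snd p *\<^sub>R fst v + snd v *\<^sub>R fst p)"
    using norm_Pair_le[of "fst v" "snd p *\<^sub>R fst v + snd v *\<^sub>R fst p"]
    by (simp add: whitney_deriv_def norm_complex_vec)
  also have "\<dots> \<le> norm (fst v) + (\<bar>snd p\<bar> * norm (fst v) + \<bar>snd v\<bar> * norm (fst p))"
    using norm_triangle_ineq[of "snd p *\<^sub>R fst v" "snd v *\<^sub>R fst p"] by simp
  also have "\<dots> \<le> 1 + (1 * 1 + 1 * 1)"
    using b by (intro add_mono mult_mono) auto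
  finally show 1: "norm (fst (whitney_deriv p v)) \<le> 3" by simp
  have "(snd p)\<^sup>2 \<le> 1" using b(1) by (simp add: abs_square_le_1)
  then have "\<bar>snd (whitney_deriv p v)\<bar> \<le> 2 * 1 * 1"
    unfolding whitney_deriv_def snd_conv abs_mult using b by (intro mult_mono) auto
  then show "norm (whitney_deriv p v) \<le> 5"
    using 1 norm_Pair_le[of "fst (whitney_deriv p v)" "snd (whitney_deriv p v)"] by simp
qed

section \<open>Upper bound: images of great circles\<close>

text \<open>\<open>w\<close> is the normalised component of \<open>q\<close> orthogonal to
  \<open>p\<close>; the length of that component is the sine of the angle.\<close>

lemma great_circle_exists:
  fixes p q :: "'a::euclidean_space"
  assumes "2 \<le> DIM('a)" "norm p = 1" "norm q = 1"
  obtains w where "norm w = 1" "p \<bullet> w = 0"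
    "q = cos (arccos (p \<bullet> q)) *\<^sub>R p + sin (arccos (p \<bullet> q)) *\<^sub>R w"
proof -
  define c where "c = p \<bullet> q"
  define h where "h = q - c *\<^sub>R p"
  have c: "\<bar>c\<bar> \<le> 1"
    using Cauchy_Schwarz_ineq2[of p q] assms by (simp add: c_def)
  have pp: "p \<bullet> p = 1" "q \<bullet> q = 1" using assms by (simp_all add: dot_square_norm)
  have ph: "p \<bullet> h = 0" by (simp add: h_def inner_diff_right pp c_def)
  have "h \<bullet> h = 1 - c\<^sup>2"
    by (simp add: h_def inner_diff_left inner_diff_right pp c_def[symmetric] inner_commute[of q p] power2_eq_square)
  then have "norm h = sin (arccos c)"
    using c by (simp add: norm_eq_sqrt_inner sin_arccos)
  moreover have "cos (arccos c) = c" using c by (simp add: cos_arccos abs_le_iff)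
  ultimately have q: "q = cos (arccos c) *\<^sub>R p + h" and h: "norm h = sin (arccos c)"
    by (simp_all add: h_def)
  show thesis
  proof (cases "h = 0")
    \<comment> \<open>Here \<open>q\<close> is \<open>p\<close> or \<open>- p\<close> and the sine
      vanishes, so any unit vector orthogonal to \<open>p\<close> will do; one exists because the
      dimension is at least 2.\<close>
    case True
    obtain y where y: "y \<noteq> 0" "orthogonal p y"
      using orthogonal_to_vector_exists[OF assms(1)] by blast
    show thesis
      by (rule that[of "y /\<^sub>R norm y"])
        (use y q h True in \<open>auto simp: orthogonal_def c_def\<close>)
  next
    case False
    have "q = cos (arccos c) *\<^sub>R p + sin (arccos c) *\<^sub>R (h /\<^sub>R norm h)"
      using q False by (simp flip: h)
    then show thesis
      using ph False by (intro that[of "h /\<^sub>R norm h"]) (auto simp: c_def)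
  qed
qed

text \<open>The curve is the image of the great circle arc from \<open>p\<close> to
  \<open>q\<close>, run at unit speed over a time equal to the angle; its horizontal speed is at
  most 3.\<close>

lemma whitney_horizontal_curve_exists:
  fixes p q :: "(real ^ 'n::finite) \<times> real"
  assumes "norm p = 1" "norm q = 1"
  obtains \<gamma> where "horizontal_curve 0 (arccos (p \<bullet> q)) \<gamma>" "\<gamma> 0 = whitney p" "\<gamma> (arccos (p \<bullet> q)) = whitney q"
    "horizontal_length 0 (arccos (p \<bullet> q)) \<gamma> \<le> ennreal (3 * arccos (p \<bullet> q))"
proof -
  define \<theta> where "\<theta> = arccos (p \<bullet> q)"
  have "\<bar>p \<bullet> q\<bar> \<le> 1"
    using Cauchy_Schwarz_ineq2[of p q] assms by simp
  then have "0 \<le> \<theta>" by (simp add: \<theta>_def arccos_lbound abs_le_iff)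
  have "2 \<le> DIM((real ^ 'n) \<times> real)" by (simp add: Suc_le_eq)
  from great_circle_exists[OF this assms] obtain w where w: "norm w = 1" "p \<bullet> w = 0"
    "q = cos \<theta> *\<^sub>R p + sin \<theta> *\<^sub>R w" unfolding \<theta>_def .
  define c where "c t = cos t *\<^sub>R p + sin t *\<^sub>R w" for t
  define v where "v t = - sin t *\<^sub>R p + cos t *\<^sub>R w" for t
  have ip: "p \<bullet> p = 1" "w \<bullet> w = 1" "w \<bullet> p = 0" using assms w by (simp_all add: dot_square_norm inner_commute)
  have n: "norm (c t) = 1" "norm (v t) = 1" for t
    using sin_cos_squared_add[of t]
    by (simp_all add: norm_eq_sqrt_inner c_def v_def inner_add_left inner_add_right inner_diff_left
        inner_diff_right ip w(2) power2_eq_square algebra_simps)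
  have c: "(c has_vector_derivative v t) (at t)" for t
    unfolding c_def v_def by (auto intro!: derivative_eq_intros)
  define \<gamma> where "\<gamma> t = whitney (c t)" for t
  have \<gamma>: "(\<gamma> has_vector_derivative whitney_deriv (c t) (v t)) (at t)" for t
    unfolding \<gamma>_def by (rule whitney_has_vector_derivative[OF c])
  have vd: "vector_derivative \<gamma> (at t) = whitney_deriv (c t) (v t)" for t
    by (rule vector_derivative_at[OF \<gamma>])
  have hor: "whitney_deriv (c t) (v t) \<in> horizontal_space (\<gamma> t)" for t
    unfolding \<gamma>_def by (rule whitney_deriv_horizontal[OF n(1)])
  have lip: "dist (\<gamma> x) (\<gamma> y) \<le> 5 * \<bar>x - y\<bar>" for x y
  proof -
    have "norm (\<gamma> x - \<gamma> y) \<le> 5 * norm (x - y)"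
    proof (rule differentiable_bound[where S = UNIV])
      show "(\<gamma> has_derivative (\<lambda>h. h *\<^sub>R whitney_deriv (c t) (v t))) (at t)" for t
        using \<gamma>[of t] by (simp add: has_vector_derivative_def)
      show "onorm (\<lambda>h. h *\<^sub>R whitney_deriv (c t) (v t)) \<le> 5" for t
        using norm_whitney_deriv_le(2)[OF n, of t t]
        by (intro onorm_le) (simp add: mult.commute[of 5] mult_left_mono)
    qed auto
    then show ?thesis by (simp add: dist_norm)
  qed
  have "\<gamma> differentiable (at t)" for t
    using \<gamma> by (rule differentiableI_vector)
  then have "horizontal_curve 0 \<theta> \<gamma>"
    unfolding horizontal_curve_def vd
    using lip hor by (auto intro!: lipschitz_imp_absolutely_continuous_curve[where C = 5])
  moreover have "horizontal_length 0 \<theta> \<gamma> \<le> ennreal (3 * \<theta>)"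
  proof -
    have "horizontal_length 0 \<theta> \<gamma> \<le> (\<integral>\<^sup>+t. 3 * indicator {0..\<theta>} t \<partial>lebesgue)"
      unfolding horizontal_length_def vd horizontal_norm_eq_norm[OF hor]
    proof (intro nn_integral_mono mult_right_mono)
      show "ennreal (norm (fst (whitney_deriv (c t) (v t)))) \<le> 3" for t
        using ennreal_leI[OF norm_whitney_deriv_le(1)[OF n, of t t]] by simp
    qed auto
    also have "\<dots> = 3 * emeasure lebesgue {0..\<theta>}"
      by (subst nn_integral_cmult_indicator) auto
    also have "\<dots> = ennreal (3 * \<theta>)"
      using \<open>0 \<le> \<theta>\<close> by (simp add: ennreal_mult)
    finally show ?thesis .
  qed
  moreover have "\<gamma> 0 = whitney p" "\<gamma> \<theta> = whitney q"
    using w(3) by (simp_all add: \<gamma>_def c_def)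
  ultimately show thesis
    using that unfolding \<theta>_def by blast
qed

section \<open>Lower bound\<close>

text \<open>With p = (x, s) and q = (y, r), the hypothesis \<open>z\<close> bounds both |y - x| and
  |r y - s x| by \<open>l\<close>. It remains to bound |r - s|. The t-coordinate does this if s and
  r do not have the same strict sign; otherwise the z-coordinate does, in two different ways
  according to the size of |r| + |s|.\<close>

lemma norm_diff_le_whitney:
  fixes p q :: "(real ^ 'n::finite) \<times> real"
  assumes pq: "norm p = 1" "norm q = 1" and "0 \<le> l"
    and z: "norm (fst (whitney q) - fst (whitney p)) \<le> l"
    and t: "\<bar>snd (whitney q) - snd (whitney p)\<bar> \<le> 2 * (2 + l) * l"
  shows "norm (q - p) \<le> 10 * l"
proof (cases "l \<ge> 1")
  \<comment> \<open>Unit vectors are at distance at most 2, so only \<open>l < 1\<close> is of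
    interest.\<close>
  case True
  then show ?thesis using norm_triangle_ineq4[of q p] pq by simp
next
  case False
  obtain x s where p: "p = (x, s)" by fastforce
  obtain y r where q: "q = (y, r)" by fastforce
  have xs: "(norm x)\<^sup>2 + s\<^sup>2 = 1" and yr: "(norm y)\<^sup>2 + r\<^sup>2 = 1"
    using pq by (simp_all add: p q norm_prod_def)
  have sr: "\<bar>s\<bar> \<le> 1" "\<bar>r\<bar> \<le> 1" and xy: "norm x \<le> 1" "norm y \<le> 1"
    using pq norm_snd_le[of s x] norm_snd_le[of r y] norm_fst_le[of x s] norm_fst_le[of y r] by (simp_all add: p q)
  have "fst (whitney q) - fst (whitney p) = complex_vec (y - x, r *\<^sub>R y - s *\<^sub>R x)"
    by (simp add: whitney_def p q flip: bounded_linear.linear[OF bounded_linear_complex_vec, THEN linear_diff])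
  then have "norm (y - x, r *\<^sub>R y - s *\<^sub>R x) \<le> l"
    using z by (simp add: norm_complex_vec)
  then have d: "norm (y - x) \<le> l" "norm (r *\<^sub>R y - s *\<^sub>R x) \<le> l"
    using norm_fst_le[of "y - x" "r *\<^sub>R y - s *\<^sub>R x"] norm_snd_le[of "r *\<^sub>R y - s *\<^sub>R x" "y - x"] by linarith+
  have mult_le: "\<bar>u\<bar> * norm (y - x) \<le> l" if "\<bar>u\<bar> \<le> 1" for u
    using mult_mono[OF that d(1)] by simp
  \<comment> \<open>Subtracting a multiple of y - x isolates r - s; both terms on each right-hand
    side have norm at most \<open>l\<close>.\<close>
  have "(r - s) *\<^sub>R y = (r *\<^sub>R y - s *\<^sub>R x) - s *\<^sub>R (y - x)" "(r - s) *\<^sub>R x = (r *\<^sub>R y - s *\<^sub>R x) - r *\<^sub>R (y - x)"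
    by (simp_all add: algebra_simps)
  then have "norm ((r - s) *\<^sub>R y) \<le> 2 * l" "norm ((r - s) *\<^sub>R x) \<le> 2 * l"
    using norm_triangle_ineq4[of "r *\<^sub>R y - s *\<^sub>R x" "s *\<^sub>R (y - x)"]
      norm_triangle_ineq4[of "r *\<^sub>R y - s *\<^sub>R x" "r *\<^sub>R (y - x)"] d(2) mult_le[OF sr(1)] mult_le[OF sr(2)]
    by simp_all
  then have A: "\<bar>r - s\<bar> * norm y \<le> 2 * l" "\<bar>r - s\<bar> * norm x \<le> 2 * l" by simp_all
  \<comment> \<open>The constant 9 comes from the first case; the other two give 2 and 4.\<close>
  have "\<bar>r - s\<bar> \<le> 9 * l"
  proof (cases "s * r \<le> 0")
    \<comment> \<open>This case contains the pairs near opposite poles, where z alone fails.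
      Factoring r - s out of the t-difference leaves 1 - (s^2 + s r + r^2) / 3, which is at least
      1/3 since s r is not positive.\<close>
    case True
    have "s\<^sup>2 \<le> 1" "r\<^sup>2 \<le> 1" using sr by (simp_all add: abs_square_le_1)
    then have "1 / 3 \<le> 1 - (s\<^sup>2 + s * r + r\<^sup>2) / 3"
      using True by simp
    have "snd (whitney q) - snd (whitney p) = - (2 * (r - s) * (1 - (s\<^sup>2 + s * r + r\<^sup>2) / 3))"
      by (simp add: whitney_def p q field_simps power2_eq_square power3_eq_cube)
    then have eq: "\<bar>snd (whitney q) - snd (whitney p)\<bar> = 2 * \<bar>r - s\<bar> * \<bar>1 - (s\<^sup>2 + s * r + r\<^sup>2) / 3\<bar>"
      by (simp only: abs_minus_cancel abs_mult abs_numeral)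
    have "2 * \<bar>r - s\<bar> * (1 / 3) \<le> \<bar>snd (whitney q) - snd (whitney p)\<bar>"
      unfolding eq using \<open>1 / 3 \<le> _\<close> by (intro mult_left_mono) auto
    moreover have "2 * (2 + l) * l \<le> 2 * 3 * l"
      using False \<open>0 \<le> l\<close> by (intro mult_right_mono) auto
    ultimately have "2 * \<bar>r - s\<bar> * (1 / 3) \<le> 2 * 3 * l"
      using t by (meson order_trans)
    then show ?thesis by simp
  next
    case same: False
    then have abs_add: "\<bar>r + s\<bar> = \<bar>r\<bar> + \<bar>s\<bar>"
      by (auto simp: not_le zero_less_mult_iff)
    show ?thesis
    proof (cases "\<bar>r\<bar> + \<bar>s\<bar> \<ge> 1")
      \<comment> \<open>Away from the equator the norm of x determines s once its sign is known: r^2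
        - s^2 = |x|^2 - |y|^2, and |r + s| is at least 1.\<close>
      case True
      have "(r - s) * (r + s) = (norm x - norm y) * (norm x + norm y)"
        using xs yr by (simp add: algebra_simps power2_eq_square)
      then have "\<bar>r - s\<bar> * \<bar>r + s\<bar> = \<bar>norm x - norm y\<bar> * (norm x + norm y)"
        by (simp flip: abs_mult) (simp add: abs_mult)
      also have "\<dots> \<le> l * 2"
        using d(1) xy norm_triangle_ineq3[of x y] \<open>0 \<le> l\<close>
        by (intro mult_mono) (auto simp: norm_minus_commute)
      finally have "\<bar>r - s\<bar> * \<bar>r + s\<bar> \<le> l * 2" .
      moreover have "\<bar>r - s\<bar> * 1 \<le> \<bar>r - s\<bar> * \<bar>r + s\<bar>"
        unfolding abs_add using True by (intro mult_left_mono) auto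
      ultimately have "\<bar>r - s\<bar> * 1 \<le> l * 2" by (rule order_trans[rotated])
      then show ?thesis using \<open>0 \<le> l\<close> by simp
    next
      case False
      \<comment> \<open>Here r^2 + s^2 is at most 1, so |x|^2 + |y|^2 is at least 1 and the two
        norms cannot both be below 1/2. One of the estimates \<open>A\<close> can then be divided by
        that norm.\<close>
      have "norm x \<ge> 1 / 2 \<or> norm y \<ge> 1 / 2"
      proof (rule ccontr)
        assume "\<not> ?thesis"
        then have "(norm x)\<^sup>2 \<le> (1/2)\<^sup>2" "(norm y)\<^sup>2 \<le> (1/2)\<^sup>2"
          by (intro power_mono; simp)+
        moreover have "(\<bar>r\<bar> + \<bar>s\<bar>)\<^sup>2 \<le> 1\<^sup>2" using False by (intro power_mono) auto
        moreover have "r\<^sup>2 + s\<^sup>2 \<le> (\<bar>r\<bar> + \<bar>s\<bar>)\<^sup>2" by (simp add: power2_sum)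
        ultimately show False using xs yr by (simp add: power2_eq_square)
      qed
      then have "\<bar>r - s\<bar> * (1 / 2) \<le> 2 * l"
      proof
        assume "norm x \<ge> 1 / 2"
        from mult_left_mono[OF this, of "\<bar>r - s\<bar>"] A(2) show ?thesis by simp
      next
        assume "norm y \<ge> 1 / 2"
        from mult_left_mono[OF this, of "\<bar>r - s\<bar>"] A(1) show ?thesis by simp
      qed
      then show ?thesis using \<open>0 \<le> l\<close> by simp
    qed
  qed
  then show ?thesis
    using d(1) norm_Pair_le[of "y - x" "r - s"] by (simp add: p q)
qed

section \<open>Comparison of the angle, the chord and \<open>d_cc\<close>\<close>

lemma arccos_inner_le:
  fixes p q :: "'a::real_inner"
  assumes "norm p = 1" "norm q = 1"
  shows "arccos (p \<bullet> q) \<le> 3 * norm (q - p)"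
proof -
  define \<theta> where "\<theta> = arccos (p \<bullet> q)"
  have "\<bar>p \<bullet> q\<bar> \<le> 1"
    using Cauchy_Schwarz_ineq2[of p q] assms by simp
  then have \<theta>: "0 \<le> \<theta>" "\<theta> \<le> pi" "cos \<theta> = p \<bullet> q"
    by (auto simp: \<theta>_def arccos_lbound arccos_ubound cos_arccos abs_le_iff)
  \<comment> \<open>The chord of the angle \<open>\<theta>\<close> is 2 sin(u) for the half angle
    \<open>u\<close>, so a linear lower bound for the sine on [0, 2] suffices.\<close>
  define u where "u = \<theta> / 2"
  have u: "0 \<le> u" "u < 2" using \<theta> pi_less_4 by (auto simp: u_def)
  have "p \<bullet> p = 1" "q \<bullet> q = 1" using assms by (simp_all add: dot_square_norm)
  then have "(norm (q - p))\<^sup>2 = 2 - 2 * (p \<bullet> q)"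
    by (simp add: power2_norm_eq_inner inner_diff_left inner_diff_right inner_commute[of q p])
  also have "p \<bullet> q = 1 - 2 * (sin u)\<^sup>2"
    using cos_double_sin[of u] by (simp add: u_def \<theta>(3))
  finally have "(norm (q - p))\<^sup>2 = (2 * sin u)\<^sup>2" by (simp add: power2_eq_square)
  moreover have "0 \<le> sin u" using \<theta> by (intro sin_ge_zero) (auto simp: u_def)
  ultimately have "norm (q - p) = 2 * sin u"
    using power2_eq_imp_eq[of "norm (q - p)" "2 * sin u"] by simp
  moreover have "u / 3 \<le> sin u"
  proof -
    \<comment> \<open>Taylor expansion gives u - sin(u) <= u^3 / 6, and u^2 <= 4 turns this into u -
      sin(u) <= 2 u / 3.\<close>
    have "(\<Sum>m<3. sin_coeff m * u ^ m) = u"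
      by (simp add: eval_nat_numeral sin_coeff_def)
    moreover have "fact 3 = (6 :: real)"
      by (simp add: fact_numeral)
    ultimately have "\<bar>sin u - u\<bar> \<le> u ^ 3 / 6"
      using Maclaurin_sin_bound[of u 3] u(1) by (simp add: field_simps)
    then have "u - sin u \<le> u ^ 3 / 6" by linarith
    moreover have "u * u\<^sup>2 \<le> u * 2\<^sup>2"
      using u by (intro mult_left_mono power_mono) auto
    ultimately show ?thesis by (simp add: power3_eq_cube power2_eq_square mult.assoc)
  qed
  ultimately show ?thesis by (simp add: u_def \<theta>_def)
qed

text \<open>The great circle image is one competitor in the infimum, which gives the upper bound.
  Every competitor of finite length \<open>l\<close> forces a chord of at most 10 \<open>l\<close>,
  and the angle is at most 3 times the chord, hence the constant 30.\<close>

lemma d_cc_whitney: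
  fixes p q :: "(real ^ 'n::finite) \<times> real"
  assumes "norm p = 1" "norm q = 1"
  shows "d_cc (whitney p) (whitney q) \<le> 3 * arccos (p \<bullet> q)"
    and "arccos (p \<bullet> q) \<le> 30 * d_cc (whitney p) (whitney q)"
proof -
  define \<theta> where "\<theta> = arccos (p \<bullet> q)"
  define I where "I = Inf {horizontal_length a b \<gamma> | a b \<gamma>.
      a \<le> b \<and> horizontal_curve a b \<gamma> \<and> \<gamma> a = whitney p \<and> \<gamma> b = whitney q}"
  have "\<bar>p \<bullet> q\<bar> \<le> 1"
    using Cauchy_Schwarz_ineq2[of p q] assms by simp
  then have "0 \<le> \<theta>" by (simp add: \<theta>_def arccos_lbound abs_le_iff)
  obtain \<gamma> where \<gamma>: "horizontal_curve 0 \<theta> \<gamma>" "\<gamma> 0 = whitney p" "\<gamma> \<theta> = whitney q"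
    "horizontal_length 0 \<theta> \<gamma> \<le> ennreal (3 * \<theta>)"
    unfolding \<theta>_def by (rule whitney_horizontal_curve_exists[OF assms])
  have "I \<le> horizontal_length 0 \<theta> \<gamma>"
    unfolding I_def using \<gamma> \<open>0 \<le> \<theta>\<close> by (intro Inf_lower) blast
  then have le: "I \<le> ennreal (3 * \<theta>)" using \<gamma>(4) by (rule order_trans)
  have ge: "ennreal (norm (q - p) / 10) \<le> I"
    unfolding I_def
  proof (rule Inf_greatest, safe)
    fix a b :: real and \<gamma> :: "real \<Rightarrow> 'n heis"
    assume *: "a \<le> b" "horizontal_curve a b \<gamma>" "\<gamma> a = whitney p" "\<gamma> b = whitney q"
    show "ennreal (norm (q - p) / 10) \<le> horizontal_length a b \<gamma>"
    proof (cases "horizontal_length a b \<gamma>")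
      case (real l)
      have "norm (fst (whitney q) - fst (whitney p)) \<le> l"
        "\<bar>snd (whitney q) - snd (whitney p)\<bar> \<le> 2 * (norm (fst (whitney p)) + l) * l"
        using horizontal_curve_diff_le[OF *(1,2), of l] real *(3,4) by auto
      moreover have "2 * (norm (fst (whitney p)) + l) * l \<le> 2 * (2 + l) * l"
        using norm_fst_whitney_le[OF assms(1)] real by (intro mult_right_mono mult_left_mono add_mono) auto
      ultimately have "norm (q - p) \<le> 10 * l"
        using norm_diff_le_whitney[OF assms, of l] real by linarith
      then show ?thesis using real by (simp add: ennreal_leI)
    qed simp
  qed
  have d: "d_cc (whitney p) (whitney q) = enn2real I"
    by (simp add: d_cc_def I_def)
  \<comment> \<open>\<open>enn2real\<close> sends \<open>top\<close> to 0, so the lower bound on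
    \<open>I\<close> passes to \<open>d_cc\<close> only once \<open>I\<close> is known to be
    finite.\<close>
  have "I < top" using le by (rule le_less_trans) simp
  then have "enn2real I \<ge> norm (q - p) / 10"
    using enn2real_mono[OF ge] by simp
  then show "arccos (p \<bullet> q) \<le> 30 * d_cc (whitney p) (whitney q)"
    using arccos_inner_le[OF assms] by (simp add: d)
  show "d_cc (whitney p) (whitney q) \<le> 3 * arccos (p \<bullet> q)"
    using enn2real_mono[OF le] \<open>0 \<le> \<theta>\<close> by (simp add: d \<theta>_def)
qed

text \<open>One coordinate \<open>m0\<close> is singled out as s and the others are relabelled by
  \<open>'n\<close>. Preserving inner products is what the theorem uses: it keeps unit vectors unit
  and leaves \<open>sphere_dist\<close> unchanged.\<close>

lemma inner_preserving_split:
  assumes "CARD('m::finite) = CARD('n::finite) + 1"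
  shows "\<exists>T :: real ^ 'm \<Rightarrow> (real ^ 'n) \<times> real. \<forall>p q. T p \<bullet> T q = p \<bullet> q"
proof -
  fix m0 :: 'm
  have "card (UNIV - {m0}) = CARD('n)" using assms by simp
  then obtain g :: "'n \<Rightarrow> 'm" where g: "bij_betw g UNIV (UNIV - {m0})"
    by (metis finite finite_same_card_bij)
  define T :: "real ^ 'm \<Rightarrow> (real ^ 'n) \<times> real" where "T p = (\<chi> j. p $ g j, p $ m0)" for p
  have "T p \<bullet> T q = p \<bullet> q" for p q
  proof -
    have "p \<bullet> q = p $ m0 * q $ m0 + (\<Sum>i\<in>UNIV - {m0}. p $ i * q $ i)"
      unfolding inner_vec_def by (subst sum.remove[of _ m0]) auto
    also have "(\<Sum>i\<in>UNIV - {m0}. p $ i * q $ i) = (\<Sum>j\<in>UNIV. p $ g j * q $ g j)"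
      by (rule sum.reindex_bij_betw[OF g, symmetric])
    finally show ?thesis by (simp add: T_def inner_vec_def)
  qed
  then show ?thesis by blast
qed

theorem theorem1p6:
  assumes "CARD('m::finite) = CARD('n::finite) + 1"
  shows "\<exists>f :: real ^ 'm \<Rightarrow> 'n heis.
           bilipschitz_embedding (sphere 0 1) sphere_dist d_cc f"
proof -
  obtain T :: "real ^ 'm \<Rightarrow> (real ^ 'n) \<times> real" where T: "\<And>p q. T p \<bullet> T q = p \<bullet> q"
    using inner_preserving_split[OF assms] by blast
  have "norm (T p) = 1" if "p \<in> sphere 0 1" for p
    using that T[of p p] by (simp add: norm_eq_sqrt_inner)
  \<comment> \<open>The upper constant 3 is weakened to 30 so that a single constant serves both
    inequalities.\<close>
  then have "sphere_dist p q / 30 \<le> d_cc (whitney (T p)) (whitney (T q)) \<and>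
      d_cc (whitney (T p)) (whitney (T q)) \<le> 30 * sphere_dist p q"
    if "p \<in> sphere 0 1" "q \<in> sphere 0 1" for p q
    using d_cc_whitney[of "T p" "T q"] that by (force simp: sphere_dist_def T)
  then show ?thesis
    unfolding bilipschitz_embedding_def by (intro exI[of _ "\<lambda>p. whitney (T p)"] exI[of _ 30]) auto
qed

end
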